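(* Let $\bm T=\{\mathcal M^{(1)},\dots,\mathcal M^{(K)}\}$ be an ensemble of classifiers $\mathcal M^{(k)}:\mathcal X\to\mathcal Y$, let $\tilde v_Y(\bm T)$ be the noisy voting mechanism with Gaussian noise of standard deviation $\sigma$, and let $h$ be a fairness function with supremum $B=\sup_{y\in\mathcal Y,\,y'\in\mathcal Y}h(y,y')$. Let $Z=(\mathcal M^{(1)}(X),\dots,\mathcal M^{(K)}(X),Y)$ and, for each $a\in[m]=\{1,\dots,m\}$, let $Z_a$ denote the conditional random vector $Z$ given $A=a$. Assume that for each group attribute $a\in[m]$ the total variation distance satisfies $d_{\mathrm{TV}}(Z,Z_a)\le\eta$. Then the voting mechanism $\tilde v_Y(\bm T)$ is $\alpha'$-fair with respect to $(X,A,Y)$ and $h$ with $$\alpha'=\eta\cdot B .$$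
   Context: $X\in\mathcal X$ is a feature vector, $A\in[m]$ a demographic group attribute, and $Y\in\mathcal Y$ a class label, jointly distributed. The noisy voting mechanism is the randomized classifier $$\tilde v_Y(\bm T(X))=\operatorname*{argmax}_{y\in\mathcal Y}\left\{\#_y(\bm T(X))+\tau_y\right\},\qquad \#_y(\bm T(X))=\left|\{k\in[K]:\mathcal M^{(k)}(X)=y\}\right|,$$ where $\tau=(\tau_y)_{y\in\mathcal Y}\sim\mathcal N(0,\sigma^2 I_{|\mathcal Y|})$ is noise drawn independently of $(X,A,Y)$. The total variation distance between two probability distributions $Z,Z'$ over a shared space $\Omega$ is $d_{\mathrm{TV}}(Z,Z')=\sup_{S\subseteq\Omega}|\Pr(Z\in S)-\Pr(Z'\in S)|$. A fairness function $h$ assigns to a prediction and a label a value $h(\mathcal M(X),Y)\in\mathbb R^c$. A (possibly randomized) classifier $\mathcal M$ is $\alpha$-fair ($\alpha\in\mathbb R_{+}^c$) with respect to $(X,A,Y)$ and $h$ if and only if $$\max_{a\in[m]}\left|\mathbb E[h(\mathcal M(X),Y)\mid A=a]-\mathbb E[h(\mathcal M(X),Y)]\right|\le\alpha ,$$ the expectation being taken also over the internal randomness (here $\tau$) of $\mathcal M$. When $c>1$, absolute values, maxima, suprema and inequalities are read componentwise.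
   Formalization: The fairness function h is assumed to have nonnegative components; for signed h the bound η·B with B = sup h fails (e.g. h(y,y') = −[y'=1] gives B = 0 but a positive fairness gap). *)

theory Defs
  imports "HOL-Probability.Probability"
begin

definition tv_dist :: "'z measure \<Rightarrow> 'z measure \<Rightarrow> real" where
  "tv_dist P Q = (SUP S\<in>sets P. \<bar>measure P S - measure Q S\<bar>)"

(* For an event of positive probability, uniform_measure M E is the conditional probability
   measure M( - | E). *)
definition cond_measure :: "'w measure \<Rightarrow> ('w \<Rightarrow> 'a) \<Rightarrow> 'a \<Rightarrow> 'w measure" where
  "cond_measure M A a = uniform_measure M {\<omega> \<in> space M. A \<omega> = a}"

(* Independence of two random variables; prob_space.indep_var requires both to have the same value
   type. *)
definition indep_rv ::
  "'w measure \<Rightarrow> 'u measure \<Rightarrow> ('w \<Rightarrow> 'u) \<Rightarrow> 'v measure \<Rightarrow> ('w \<Rightarrow> 'v) \<Rightarrow> bool" where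
  "indep_rv M S U R V \<longleftrightarrow>
     U \<in> measurable M S \<and> V \<in> measurable M R \<and>
     prob_space.indep_set M {U -` B \<inter> space M | B. B \<in> sets S} {V -` B \<inter> space M | B. B \<in> sets R}"

(* The ensemble is indexed by a finite type 'k, so K = CARD('k). *)
definition ensemble_out :: "('k::finite \<Rightarrow> 'x \<Rightarrow> 'y) \<Rightarrow> 'x \<Rightarrow> 'y ^ 'k" where
  "ensemble_out T x = (\<chi> k. T k x)"

definition votes :: "'y ^ 'k::finite \<Rightarrow> 'y \<Rightarrow> nat" where
  "votes t y = card {k. t $ k = y}"

(* Ties, a null event under Gaussian noise, are broken by the fixed choice made by arg_max. *)
definition noisy_vote :: "'y ^ 'k::finite \<Rightarrow> ('y \<Rightarrow> real) \<Rightarrow> 'y" where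
  "noisy_vote t \<tau> = (ARG_MAX (\<lambda>y. real (votes t y) + \<tau> y) y. True)"

(* The law N(0, s^2 I) on real vectors indexed by the type 'y, for s > 0. *)
definition isotropic_gaussian :: "real \<Rightarrow> ('y \<Rightarrow> real) measure" where
  "isotropic_gaussian s =
     (\<Pi>\<^sub>M y\<in>UNIV. density lborel (\<lambda>x. ennreal (normal_density 0 s x)))"

(* Fairness of a possibly randomized classifier, given through its random prediction on the
   common probability space M, which also carries the internal randomness of the classifier.
   For m >= 1 the inequality forces the components of alpha to be nonnegative. *)
definition fair ::
  "'w measure \<Rightarrow> nat \<Rightarrow> ('w \<Rightarrow> nat) \<Rightarrow> ('w \<Rightarrow> 'y) \<Rightarrow> ('y \<Rightarrow> 'y \<Rightarrow> real ^ 'c::finite)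
     \<Rightarrow> ('w \<Rightarrow> 'y) \<Rightarrow> real ^ 'c \<Rightarrow> bool" where
  "fair M m A Y h pred \<alpha> \<longleftrightarrow>
     (\<forall>i. (MAX a\<in>{1..m}.
            \<bar>((\<integral>\<omega>. h (pred \<omega>) (Y \<omega>) \<partial>cond_measure M A a)
               - (\<integral>\<omega>. h (pred \<omega>) (Y \<omega>) \<partial>M)) $ i\<bar>) \<le> \<alpha> $ i)"

definition fairness_sup :: "('y \<Rightarrow> 'y \<Rightarrow> real ^ 'c::finite) \<Rightarrow> real ^ 'c" where
  "fairness_sup h = (\<chi> i. SUP (y, y')\<in>UNIV. h y y' $ i)"

end

(* Z takes finitely many values, and conditionally on Z = z the prediction is a function of the noise
   alone, whose law is the same under M and under M given A = a. Hence both expectations of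
   h are averages of one function G, with 0 <= G <= B, over the laws of Z and of Z_a. For p, q
   these laws and S the set where p >= q, the difference of the averages is at most
   B * (p S - q S) in one direction and, on the complement of S, likewise in the other. *)
theory Submission
  imports Defs
begin

section \<open>Expectations of functions of finitely valued random variables\<close>

lemma integral_finite_valued:
  fixes F :: "'b::finite \<Rightarrow> 'e::{banach, second_countable_topology}"
  assumes "finite_measure N" and W: "W \<in> measurable N (count_space UNIV)"
  shows "(\<integral>\<omega>. F (W \<omega>) \<partial>N) = (\<Sum>w\<in>UNIV. measure N {\<omega> \<in> space N. W \<omega> = w} *\<^sub>R F w)"
proof -
  interpret finite_measure N by fact
  have m: "{\<omega> \<in> space N. W \<omega> = w} \<in> sets N" for w
    using W by measurable
  have "(\<integral>\<omega>. F (W \<omega>) \<partial>N)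
      = (\<integral>\<omega>. (\<Sum>w\<in>UNIV. indicator {\<omega> \<in> space N. W \<omega> = w} \<omega> *\<^sub>R F w) \<partial>N)"
  proof (rule Bochner_Integration.integral_cong[OF refl])
    fix \<omega> assume "\<omega> \<in> space N"
    then have "(\<Sum>w\<in>UNIV. indicator {\<omega> \<in> space N. W \<omega> = w} \<omega> *\<^sub>R F w)
        = (\<Sum>w\<in>UNIV. if w = W \<omega> then F w else 0)"
      by (intro sum.cong) (auto simp: indicator_def)
    then show "F (W \<omega>) = (\<Sum>w\<in>UNIV. indicator {\<omega> \<in> space N. W \<omega> = w} \<omega> *\<^sub>R F w)"
      by simp
  qed
  also have "\<dots> = (\<Sum>w\<in>UNIV. \<integral>\<omega>. indicator {\<omega> \<in> space N. W \<omega> = w} \<omega> *\<^sub>R F w \<partial>N)"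
    using m by (intro Bochner_Integration.integral_sum integrable_scaleR_left)
      (auto simp: integrable_indicator_iff emeasure_finite less_top[symmetric])
  also have "\<dots> = (\<Sum>w\<in>UNIV. measure N {\<omega> \<in> space N. W \<omega> = w} *\<^sub>R F w)"
  proof (rule sum.cong[OF refl])
    fix w
    have "{\<omega> \<in> space N. W \<omega> = w} \<inter> space N = {\<omega> \<in> space N. W \<omega> = w}" by auto
    then show "(\<integral>\<omega>. indicator {\<omega> \<in> space N. W \<omega> = w} \<omega> *\<^sub>R F w \<partial>N)
        = measure N {\<omega> \<in> space N. W \<omega> = w} *\<^sub>R F w"
      using m[of w] by (subst integral_scaleR_left)
        (auto simp: integrable_indicator_iff emeasure_finite less_top[symmetric])
  qed
  finally show ?thesis .
qed

text \<open>The factor \<open>n z v\<close> acts as the conditional probability of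
  \<open>V = v\<close> given \<open>Z = z\<close>; the product form avoids dividing by the
  probability of \<open>Z = z\<close>, which may vanish. Two measures with the same \<open>n\<close>
  thus average the same inner sum, only with different weights.\<close>

lemma integral_pair_kernel:
  fixes F :: "'z::finite \<Rightarrow> 'v::finite \<Rightarrow> 'e::{banach, second_countable_topology}"
  assumes "finite_measure N"
    and Z: "Z \<in> measurable N (count_space UNIV)"
    and V: "V \<in> measurable N (count_space UNIV)"
    and kernel: "\<And>z v. measure N {\<omega> \<in> space N. Z \<omega> = z \<and> V \<omega> = v}
                  = measure N {\<omega> \<in> space N. Z \<omega> = z} * n z v"
  shows "(\<integral>\<omega>. F (Z \<omega>) (V \<omega>) \<partial>N)
    = (\<Sum>z\<in>UNIV. measure (distr N (count_space UNIV) Z) {z} *\<^sub>R (\<Sum>v\<in>UNIV. n z v *\<^sub>R F z v))"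
proof -
  have ZV: "(\<lambda>\<omega>. (Z \<omega>, V \<omega>)) \<in> measurable N (count_space UNIV)"
    using measurable_Pair[OF Z V] by (simp add: pair_measure_countable)
  have p: "measure (distr N (count_space UNIV) Z) {z} = measure N {\<omega> \<in> space N. Z \<omega> = z}" for z
    by (subst measure_distr[OF Z]) (auto intro!: arg_cong[where f = "measure N"])
  have "(\<integral>\<omega>. F (Z \<omega>) (V \<omega>) \<partial>N)
      = (\<Sum>(z, v)\<in>UNIV. measure N {\<omega> \<in> space N. Z \<omega> = z \<and> V \<omega> = v} *\<^sub>R F z v)"
    using integral_finite_valued[OF assms(1) ZV, of "\<lambda>(z, v). F z v"] by (simp add: case_prod_beta prod_eq_iff)
  also have "\<dots> = (\<Sum>z\<in>UNIV. \<Sum>v\<in>UNIV. (measure N {\<omega> \<in> space N. Z \<omega> = z} * n z v) *\<^sub>R F z v)"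
    by (simp add: kernel sum.cartesian_product UNIV_Times_UNIV[symmetric] del: UNIV_Times_UNIV)
  also have "\<dots> = (\<Sum>z\<in>UNIV. measure (distr N (count_space UNIV) Z) {z} *\<^sub>R (\<Sum>v\<in>UNIV. n z v *\<^sub>R F z v))"
    by (simp add: p scaleR_sum_right)
  finally show ?thesis .
qed

section \<open>Total variation distance and weighted sums\<close>

lemma measure_diff_le_tv_dist:
  assumes "prob_space P" "prob_space Q" "S \<in> sets P"
  shows "\<bar>measure P S - measure Q S\<bar> \<le> tv_dist P Q"
proof -
  interpret P: prob_space P by fact
  interpret Q: prob_space Q by fact
  \<comment> \<open>The real \<open>SUP\<close> in \<open>tv_dist\<close> is an upper bound only for
    a bounded family; 1 bounds every difference of two probabilities.\<close>
  have "\<bar>measure P S' - measure Q S'\<bar> \<le> 1" for S'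
    using P.prob_le_1[of S'] Q.prob_le_1[of S'] measure_nonneg[of P S'] measure_nonneg[of Q S'] by linarith
  then show ?thesis
    unfolding tv_dist_def using assms(3) by (intro cSUP_upper bdd_aboveI2[where M = 1]) auto
qed

lemma weighted_sum_diff_le_tv_dist:
  fixes P Q :: "'z::finite measure"
  assumes "prob_space P" "prob_space Q" and sets: "sets P = UNIV" "sets Q = UNIV"
    and G: "\<And>z. 0 \<le> G z" "\<And>z. G z \<le> B"
  shows "(\<Sum>z\<in>UNIV. (measure P {z} - measure Q {z}) * G z) \<le> tv_dist P Q * B"
proof -
  interpret P: prob_space P by fact
  interpret Q: prob_space Q by fact
  define S where "S = {z. measure Q {z} \<le> measure P {z}}"
  have B: "0 \<le> B" using G order_trans by blast
  \<comment> \<open>On \<open>S\<close> the difference is nonnegative, so \<open>G z\<close> may be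
    raised to \<open>B\<close>; off \<open>S\<close> it is negative and \<open>0 \<le> G z\<close>,
    so the term may be dropped.\<close>
  have "(\<Sum>z\<in>UNIV. (measure P {z} - measure Q {z}) * G z)
      \<le> (\<Sum>z\<in>UNIV. if z \<in> S then (measure P {z} - measure Q {z}) * B else 0)"
    using G by (intro sum_mono) (auto simp: S_def mult_left_mono mult_nonpos_nonneg)
  also have "\<dots> = (\<Sum>z\<in>S. measure P {z} - measure Q {z}) * B"
    by (simp add: sum.If_cases sum_distrib_right)
  also have "\<dots> = (measure P S - measure Q S) * B"
    using P.finite_measure_eq_sum_singleton[of S] Q.finite_measure_eq_sum_singleton[of S] sets
    by (simp add: sum_subtractf)
  also have "\<dots> \<le> tv_dist P Q * B"
    using measure_diff_le_tv_dist[OF assms(1,2), of S] sets B by (intro mult_right_mono) auto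
  finally show ?thesis .
qed

lemma tv_dist_commute:
  assumes "sets P = sets Q"
  shows "tv_dist P Q = tv_dist Q P"
  unfolding tv_dist_def assms by (simp add: abs_minus_commute)

text \<open>Swapping \<open>P\<close> and \<open>Q\<close> negates the sum and preserves
  \<open>tv_dist\<close>, so the one-sided bound in both orders controls the absolute value.\<close>

lemma abs_weighted_sum_diff_le_tv_dist:
  fixes P Q :: "'z::finite measure"
  assumes "prob_space P" "prob_space Q" and sets: "sets P = UNIV" "sets Q = UNIV"
    and G: "\<And>z. 0 \<le> G z" "\<And>z. G z \<le> B"
  shows "\<bar>\<Sum>z\<in>UNIV. (measure P {z} - measure Q {z}) * G z\<bar> \<le> tv_dist P Q * B"
proof -
  have "- (\<Sum>z\<in>UNIV. (measure P {z} - measure Q {z}) * G z)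
      = (\<Sum>z\<in>UNIV. (measure Q {z} - measure P {z}) * G z)"
    by (simp add: sum_negf[symmetric] algebra_simps)
  then show ?thesis
    using weighted_sum_diff_le_tv_dist[OF assms(1,2) sets G]
      weighted_sum_diff_le_tv_dist[OF assms(2,1) sets(2,1) G] tv_dist_commute[of P Q] sets
    by (simp add: abs_le_iff)
qed

section \<open>Independence, measurability of the noisy vote, and the supremum of the fairness
  function\<close>

lemma indep_rv_prob:
  assumes "prob_space M" "indep_rv M S U R V" "B \<in> sets S" "C \<in> sets R"
  shows "measure M {\<omega> \<in> space M. U \<omega> \<in> B \<and> V \<omega> \<in> C}
    = measure M {\<omega> \<in> space M. U \<omega> \<in> B} * measure M {\<omega> \<in> space M. V \<omega> \<in> C}"
proof -
  interpret prob_space M by fact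
  have "prob ((U -` B \<inter> space M) \<inter> (V -` C \<inter> space M)) = prob (U -` B \<inter> space M) * prob (V -` C \<inter> space M)"
    using assms(2-4) unfolding indep_rv_def by (intro indep_setD) auto
  moreover have "(U -` B \<inter> space M) \<inter> (V -` C \<inter> space M) = {\<omega> \<in> space M. U \<omega> \<in> B \<and> V \<omega> \<in> C}"
    "U -` B \<inter> space M = {\<omega> \<in> space M. U \<omega> \<in> B}" "V -` C \<inter> space M = {\<omega> \<in> space M. V \<omega> \<in> C}"
    by auto
  ultimately show ?thesis by simp
qed

(* arg_max depends on the scores only through the set of maximizers, one of finitely many sets. *)
lemma measurable_noisy_vote:
  fixes t :: "'y::finite ^ 'k::finite"
  shows "noisy_vote t \<in> measurable (\<Pi>\<^sub>M y\<in>UNIV. borel) (count_space UNIV)"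
proof -
  let ?N = "(\<Pi>\<^sub>M y\<in>UNIV. borel) :: ('y \<Rightarrow> real) measure"
  define D where "D \<tau> = {x. \<forall>y. real (votes t y) + \<tau> y \<le> real (votes t x) + \<tau> x}" for \<tau>
  \<comment> \<open>\<open>arg_max\<close> chooses by \<open>SOME\<close> a class whose score no
    other score strictly exceeds, which in a linear order is membership in
    \<open>D \<tau>\<close>.\<close>
  have eq: "noisy_vote t = (\<lambda>\<tau>. SOME x. x \<in> D \<tau>)"
    by (rule ext) (simp add: noisy_vote_def arg_max_def is_arg_max_def D_def not_less)
  have "{\<tau> \<in> space ?N. D \<tau> = E} \<in> sets ?N" for E
  proof -
    have score: "(\<lambda>\<tau>. real (votes t y) + \<tau> y) \<in> borel_measurable ?N" for y
      by (intro borel_measurable_add borel_measurable_const measurable_component_singleton) simp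
    have [measurable]: "Measurable.pred ?N (\<lambda>\<tau>. real (votes t y) + \<tau> y \<le> real (votes t x) + \<tau> x)" for x y
      unfolding pred_def by (rule borel_measurable_le[OF score score])
    have "{\<tau> \<in> space ?N. D \<tau> = E} = {\<tau> \<in> space ?N. \<forall>x. (\<forall>y. real (votes t y) + \<tau> y \<le> real (votes t x) + \<tau> x) \<longleftrightarrow> x \<in> E}"
      by (auto simp: D_def)
    also have "\<dots> \<in> sets ?N"
      by measurable
    finally show ?thesis .
  qed
  then have "D \<in> measurable ?N (count_space UNIV)"
    by (subst measurable_count_space_eq2) (auto simp: vimage_def Int_def conj_commute)
  \<comment> \<open>Every function on a discrete space is measurable, whatever the choice operator
    picks among tied classes.\<close>
  then show ?thesis
    unfolding eq by (rule measurable_compose) simp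
qed

lemma le_fairness_sup:
  fixes h :: "'y::finite \<Rightarrow> 'y \<Rightarrow> real ^ 'c::finite"
  shows "h y y' $ i \<le> fairness_sup h $ i"
  unfolding fairness_sup_def
  using cSUP_upper[of "(y, y')" UNIV "\<lambda>(y, y'). h y y' $ i"] by simp

theorem theorem2:
  fixes M :: "'w measure" and MX :: "'x measure"
    and X :: "'w \<Rightarrow> 'x" and A :: "'w \<Rightarrow> nat" and Y :: "'w \<Rightarrow> 'y::finite"
    and \<tau> :: "'w \<Rightarrow> 'y \<Rightarrow> real"
    and T :: "'k::finite \<Rightarrow> 'x \<Rightarrow> 'y"
    and h :: "'y \<Rightarrow> 'y \<Rightarrow> real ^ 'c::finite"
    and m :: nat and \<sigma> \<eta> :: real
  defines "Z \<equiv> (\<lambda>\<omega>. (ensemble_out T (X \<omega>), Y \<omega>))"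
  assumes "prob_space M"
    and "X \<in> measurable M MX"
    and "A \<in> measurable M (count_space {1..m})"
    and "Y \<in> measurable M (count_space UNIV)"
    and "\<And>a. a \<in> {1..m} \<Longrightarrow> measure M {\<omega> \<in> space M. A \<omega> = a} > 0"
    and "\<And>k. T k \<in> measurable MX (count_space UNIV)"
    and "\<sigma> > 0"
    and "distr M (\<Pi>\<^sub>M y\<in>UNIV. borel) \<tau> = isotropic_gaussian \<sigma>"
    and "indep_rv M
           (\<Pi>\<^sub>M y\<in>UNIV. borel) \<tau>
           (MX \<Otimes>\<^sub>M count_space {1..m} \<Otimes>\<^sub>M count_space UNIV) (\<lambda>\<omega>. (X \<omega>, A \<omega>, Y \<omega>))"
    and "\<And>y y' i. h y y' $ i \<ge> 0"
    and "\<And>a. a \<in> {1..m} \<Longrightarrow>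
           tv_dist (distr M (count_space UNIV) Z)
                   (distr (cond_measure M A a) (count_space UNIV) Z) \<le> \<eta>"
  shows "fair M m A Y h (\<lambda>\<omega>. noisy_vote (ensemble_out T (X \<omega>)) (\<tau> \<omega>)) (\<eta> *\<^sub>R fairness_sup h)"
proof -
  let ?V = "\<lambda>\<omega>. noisy_vote (ensemble_out T (X \<omega>)) (\<tau> \<omega>)"
  let ?R = "MX \<Otimes>\<^sub>M count_space {1..m} \<Otimes>\<^sub>M count_space UNIV"
  let ?N = "(\<Pi>\<^sub>M y\<in>UNIV. borel) :: ('y \<Rightarrow> real) measure"
  \<comment> \<open>The law of the prediction when the votes are frozen at \<open>fst z\<close> and
    only the noise is random.\<close>
  define n where "n z v = measure M {\<omega> \<in> space M. noisy_vote (fst z) (\<tau> \<omega>) = v}" for z :: "('y ^ 'k) \<times> 'y" and v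
  \<comment> \<open>The conditional expectation of \<open>h\<close> given \<open>Z = z\<close>: the
    label is fixed at \<open>snd z\<close>, the prediction has law \<open>n z\<close>.\<close>
  define G where "G z = (\<Sum>v\<in>UNIV. n z v *\<^sub>R h v (snd z))" for z
  interpret prob_space M by fact
  note X[measurable] = assms(3) and A[measurable] = assms(4) and Y[measurable] = assms(5)
    and T[measurable] = assms(7)
  have \<tau>[measurable]: "\<tau> \<in> measurable M ?N"
    using assms(10) by (simp add: indep_rv_def)
  have ens: "{x \<in> space MX. ensemble_out T x = t} \<in> sets MX" for t
    unfolding ensemble_out_def vec_eq_iff by simp measurable
  have ens_meas[measurable]: "ensemble_out T \<in> measurable MX (count_space UNIV)"
    using ens by (subst measurable_count_space_eq2) (auto simp: vimage_def Int_def conj_commute)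
  have Z: "Z \<in> measurable M (count_space UNIV)"
    using measurable_Pair[OF measurable_compose[OF X ens_meas] Y]
    by (simp add: Z_def pair_measure_countable)
  have noise: "(\<lambda>\<omega>. noisy_vote t (\<tau> \<omega>)) \<in> measurable M (count_space UNIV)" for t :: "'y ^ 'k"
    by (rule measurable_compose[OF \<tau> measurable_noisy_vote])
  \<comment> \<open>The vote vector takes finitely many values, so measurability for each fixed
    vector suffices.\<close>
  have V: "?V \<in> measurable M (count_space UNIV)"
    by (rule measurable_compose_countable[OF noise measurable_compose[OF X ens_meas]])
  \<comment> \<open>On the event \<open>Z = z\<close> the prediction is a function of \<tau> alone.
    The set \<open>C\<close> serves both expectations: \<open>UNIV\<close> gives the law under
    \<open>M\<close>, and \<open>{a}\<close> the law conditioned on \<open>A = a\<close>.\<close>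
  have indep: "measure M {\<omega> \<in> space M. A \<omega> \<in> C \<and> Z \<omega> = z \<and> ?V \<omega> = v}
      = measure M {\<omega> \<in> space M. A \<omega> \<in> C \<and> Z \<omega> = z} * n z v" for C z v
  proof -
    let ?B = "{s \<in> space ?N. noisy_vote (fst z) s = v}"
    \<comment> \<open>Intersecting with \<open>{1..m}\<close> keeps the set inside the space of the
      group attribute for arbitrary \<open>C\<close>.\<close>
    let ?C = "{x \<in> space MX. ensemble_out T x = fst z} \<times> (C \<inter> {1..m}) \<times> {snd z}"
    have B: "?B \<in> sets ?N"
      using measurable_noisy_vote[of "fst z"] by measurable
    have C: "?C \<in> sets ?R"
      using ens by (intro pair_measureI) auto
    have sp: "\<tau> \<omega> \<in> space ?N" "X \<omega> \<in> space MX" "A \<omega> \<in> {1..m}" if "\<omega> \<in> space M" for \<omega>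
      using that measurable_space[OF \<tau>] measurable_space[OF X] measurable_space[OF A]
      by auto
    have "{\<omega> \<in> space M. A \<omega> \<in> C \<and> Z \<omega> = z \<and> ?V \<omega> = v}
        = {\<omega> \<in> space M. \<tau> \<omega> \<in> ?B \<and> (X \<omega>, A \<omega>, Y \<omega>) \<in> ?C}"
      using sp by (auto simp: Z_def prod_eq_iff)
    moreover have "{\<omega> \<in> space M. A \<omega> \<in> C \<and> Z \<omega> = z} = {\<omega> \<in> space M. (X \<omega>, A \<omega>, Y \<omega>) \<in> ?C}"
      using sp by (auto simp: Z_def prod_eq_iff)
    moreover have "n z v = measure M {\<omega> \<in> space M. \<tau> \<omega> \<in> ?B}"
      unfolding n_def using sp by (intro arg_cong[where f = "measure M"]) auto
    ultimately show ?thesis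
      using indep_rv_prob[OF assms(2,10) B C] by (simp add: mult.commute)
  qed
  have n_sum: "(\<Sum>v\<in>UNIV. n z v) = 1" for z
    using integral_finite_valued[OF finite_measure_axioms noise[of "fst z"], of "\<lambda>_. 1 :: real"]
    by (simp add: n_def prob_space)
  have G_nonneg: "0 \<le> G z $ i" for z i
    using assms(11) by (auto simp: G_def n_def intro!: sum_nonneg)
  have G_le: "G z $ i \<le> fairness_sup h $ i" for z i
  proof -
    have "G z $ i \<le> (\<Sum>v\<in>UNIV. n z v * fairness_sup h $ i)"
      unfolding G_def by (auto simp: n_def intro!: sum_mono mult_left_mono le_fairness_sup)
    then show ?thesis
      by (simp add: sum_distrib_right[symmetric] n_sum)
  qed
  have int: "(\<integral>\<omega>. h (?V \<omega>) (Y \<omega>) \<partial>M)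
      = (\<Sum>z\<in>UNIV. measure (distr M (count_space UNIV) Z) {z} *\<^sub>R G z)"
    using integral_pair_kernel[OF finite_measure_axioms Z V, of n "\<lambda>z v. h v (snd z)"] indep[of UNIV]
    by (simp add: G_def) (simp add: Z_def)
  have bound: "\<bar>((\<integral>\<omega>. h (?V \<omega>) (Y \<omega>) \<partial>cond_measure M A a) - (\<integral>\<omega>. h (?V \<omega>) (Y \<omega>) \<partial>M)) $ i\<bar>
      \<le> \<eta> * fairness_sup h $ i" if a: "a \<in> {1..m}" for a i
  proof -
    let ?E = "{\<omega> \<in> space M. A \<omega> = a}"
    let ?U = "cond_measure M A a"
    let ?P = "distr M (count_space UNIV) Z" and ?Q = "distr ?U (count_space UNIV) Z"
    have E: "?E \<in> sets M"
      using measurable_sets[OF A, of "{a}"] a by (simp add: vimage_def Int_def conj_commute)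
    have pos: "0 < measure M ?E" using assms(6)[OF a] .
    have sets_U[measurable_cong]: "sets ?U = sets M" and space_U: "space ?U = space M"
      by (simp_all add: cond_measure_def)
    interpret U: prob_space ?U
      unfolding cond_measure_def using pos
      by (intro prob_space_uniform_measure) (auto simp: emeasure_eq_measure)
    \<comment> \<open>Membership in \<open>{a}\<close> instead of equality matches the shape of
      \<open>indep\<close> at \<open>C = {a}\<close>.\<close>
    have measure_U: "measure ?U {\<omega> \<in> space M. P \<omega>} = measure M {\<omega> \<in> space M. A \<omega> \<in> {a} \<and> P \<omega>} / measure M ?E"
      if "{\<omega> \<in> space M. P \<omega>} \<in> sets M" for P
    proof -
      have "?E \<inter> {\<omega> \<in> space M. P \<omega>} = {\<omega> \<in> space M. A \<omega> \<in> {a} \<and> P \<omega>}" by auto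
      then show ?thesis
        unfolding cond_measure_def using E that pos
        by (subst measure_uniform_measure) (auto simp: emeasure_eq_measure)
    qed
    have Z_sets: "{\<omega> \<in> space M. Z \<omega> = z} \<in> sets M" for z
      using Z by measurable
    have ZV_sets: "{\<omega> \<in> space M. Z \<omega> = z \<and> ?V \<omega> = v} \<in> sets M" for z v
      using Z V by measurable
    have ZU: "Z \<in> measurable ?U (count_space UNIV)" and VU: "?V \<in> measurable ?U (count_space UNIV)"
      using Z V by (simp_all cong: measurable_cong_sets add: sets_U)
    \<comment> \<open>Dividing the factorization for \<open>C = {a}\<close> by the probability of
      \<open>A = a\<close> leaves \<open>n z v\<close> unchanged, so the conditional measure has the
      same kernel as \<open>M\<close>.\<close>
    have "measure ?U {\<omega> \<in> space ?U. Z \<omega> = z \<and> ?V \<omega> = v} = measure ?U {\<omega> \<in> space ?U. Z \<omega> = z} * n z v" for z v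
      unfolding space_U measure_U[OF Z_sets] measure_U[OF ZV_sets] indep by simp
    then have "(\<integral>\<omega>. h (?V \<omega>) (Y \<omega>) \<partial>?U) = (\<Sum>z\<in>UNIV. measure ?Q {z} *\<^sub>R G z)"
      using integral_pair_kernel[OF U.finite_measure_axioms ZU VU, of n "\<lambda>z v. h v (snd z)"]
      by (simp add: G_def) (simp add: Z_def)
    \<comment> \<open>Both expectations average the same \<open>G\<close>. The order of
      \<open>?P\<close> and \<open>?Q\<close> is reversed on the right, which the absolute value
      absorbs.\<close>
    then have "\<bar>((\<integral>\<omega>. h (?V \<omega>) (Y \<omega>) \<partial>?U) - (\<integral>\<omega>. h (?V \<omega>) (Y \<omega>) \<partial>M)) $ i\<bar>
        = \<bar>\<Sum>z\<in>UNIV. (measure ?P {z} - measure ?Q {z}) * G z $ i\<bar>"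
      by (simp add: int sum_subtractf[symmetric] left_diff_distrib abs_minus_commute)
        (simp add: sum_subtractf abs_minus_commute)
    also have "\<dots> \<le> tv_dist ?P ?Q * fairness_sup h $ i"
      using prob_space_distr[OF Z] U.prob_space_distr[OF ZU] G_nonneg G_le
      by (intro abs_weighted_sum_diff_le_tv_dist) auto
    \<comment> \<open>Monotonicity needs a nonnegative supremum, which follows from \<open>G\<close>
      lying between 0 and it.\<close>
    also have "\<dots> \<le> \<eta> * fairness_sup h $ i"
      using assms(12)[OF a] order_trans[OF G_nonneg G_le] by (intro mult_right_mono)
    finally show ?thesis .
  qed
  \<comment> \<open>\<open>Max\<close> is meaningful only on a nonempty set; a probability space has
    a point, and \<open>A\<close> sends it into \<open>{1..m}\<close>.\<close>
  have "{1..m} \<noteq> {}"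
    using not_empty measurable_space[OF A] by fastforce
  then show ?thesis
    unfolding fair_def using bound by (auto intro!: Max.boundedI)
qed

end
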